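(* Let $\mathcal{S}$ be a finite set of irreducible polynomials in $\mathbb{F}_q[X]$, and let $\{f_n\}_{n\ge 1}$ be a consecutive polynomial sequence over $\mathbb{F}_q$ of infinite length. For any integers $m\ge 0$ and $H\ge 2$, denote by $Q(m,H;\mathcal{S})$ the number of $\mathcal{S}$-polynomials amongst $f_{m+1},f_{m+2},\ldots,f_{m+H}$. Then $$Q(m,H;\mathcal{S}) \ll |\mathcal{S}|\,\log H\,\log(m+H).$$
   Context: Let $p$ be an odd prime, $q=p^s$ with $s\ge 1$ an integer, and $\mathbb{F}_q$ the finite field with $q$ elements. Given an infinite sequence $\{u_n\}_{n\ge 0}$ of non-zero elements of $\mathbb{F}_q$, the associated consecutive polynomial sequence (of infinite length) is $\{f_n\}_{n\ge 1}$, where $f_n=u_nX^n+\cdots+u_1X+u_0\in\mathbb{F}_q[X]$. A polynomial $f\in\mathbb{F}_q[X]$ is called an $\mathcal{S}$-polynomial if all its irreducible factors (up to non-zero constant multiples) are contained in $\mathcal{S}$. The notation $U\ll V$ means $|U|\le cV$ for some absolute constant $c>0$, independent of all parameters (including $q$, $m$, $H$, $\mathcal{S}$ and the sequence). *)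

theory Defs
  imports Complex_Main "HOL-Computational_Algebra.Primes" "HOL-Algebra.Polynomial_Divisibility"
begin

(* HOL-Algebra represents a polynomial by the list of its coefficients in descending order,
   so that [c] is the constant polynomial c, and this list is u_n X^n + ... + u_1 X + u_0. *)
definition consecutive_poly :: "(nat \<Rightarrow> 'a) \<Rightarrow> nat \<Rightarrow> 'a list" where
  "consecutive_poly u n = map u (rev [0..<Suc n])"

lemma consecutive_poly_carrier:
  assumes "\<And>n. u n \<in> carrier F - {\<zero>\<^bsub>F\<^esub>}"
  shows "consecutive_poly u n \<in> carrier (poly_ring F)"
  using assms by (auto simp: consecutive_poly_def univ_poly_def polynomial_def)

lemma (in ring) coeff_consecutive_poly:
  "coeff (consecutive_poly u n) i = (if i \<le> n then u i else \<zero>)"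
  by (induction n) (auto simp: consecutive_poly_def)

definition S_polynomial :: "('a, 'b) ring_scheme \<Rightarrow> 'a list set \<Rightarrow> 'a list \<Rightarrow> bool" where
  "S_polynomial F S f \<longleftrightarrow>
     f \<in> carrier (poly_ring F) \<and>
     (\<forall>g\<in>carrier (poly_ring F). pirreducible\<^bsub>F\<^esub> (carrier F) g \<longrightarrow> g pdivides\<^bsub>F\<^esub> f \<longrightarrow>
        (\<exists>h\<in>S. \<exists>c\<in>carrier F - {\<zero>\<^bsub>F\<^esub>}. g = [c] \<otimes>\<^bsub>poly_ring F\<^esub> h))"

definition Q :: "('a, 'b) ring_scheme \<Rightarrow> (nat \<Rightarrow> 'a) \<Rightarrow> 'a list set \<Rightarrow> nat \<Rightarrow> nat \<Rightarrow> nat" where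
  "Q F u S m H = card {n \<in> {m + 1..m + H}. S_polynomial F S (consecutive_poly u n)}"

(* The absolute constant must not depend on the field, so the statement using these notions
   quantifies over fields F, as HOL-Algebra structures, inside the scope of the constant.
   With a type class the field would be a type, fixed before the constant is chosen.
   The carrier type 'a is arbitrary; already for 'a = nat (or any infinite type) F ranges
   over isomorphic copies of all finite fields of odd characteristic. *)

end

(* Write d_g(n) for the degree of the g-part of f_n. If f_n is an S-polynomial, then n is the sum
   of d_g(n) over g in S. For n < n' the difference f_n' - f_n is X^(n+1) times a non-zero
   polynomial of degree n' - n - 1, and f_n has non-zero constant term, so for each g the smaller
   of d_g(n), d_g(n') is less than n' - n. Halving a window of length 2^k repeatedly shows that the
   sum of d_g over the window, without one exceptional n, is at most k 2^k. Applied to the part of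
   m+1, ..., m+H in a dyadic block, this bounds the number of S-polynomials there by O(|S| log H),
   and O(log (m+H)) dyadic blocks suffice. *)
theory Submission
  imports Defs
begin

section \<open>Counting with abstract weights\<close>

text \<open>Each half of the window leaves out at most one point. If both of these points lie in
  \<open>A\<close>, the separation bounds \<open>d\<close> by the window length 2^(k+1) at one of
  them, so that point can be put back. The totals match: 2 * k * 2^k + 2^(k+1) = (k+1) *
  2^(k+1).\<close>

lemma sum_bound_except_one:
  fixes d :: "nat \<Rightarrow> nat"
  assumes "A \<subseteq> {a..<a + 2 ^ k}"
    and "\<And>x y. x \<in> A \<Longrightarrow> y \<in> A \<Longrightarrow> x < y \<Longrightarrow> min (d x) (d y) \<le> y - x"
  shows "\<exists>z. (\<Sum>x\<in>A - {z}. d x) \<le> k * 2 ^ k"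
  using assms
proof (induction k arbitrary: a A)
  case 0
  then have "A - {a} = {}" by auto
  then show ?case by (metis sum.empty le0)
next
  case (Suc k)
  have fin: "finite A" using Suc.prems(1) finite_subset by blast
  define B where "B = A \<inter> {..<a + 2 ^ k}"
  define C where "C = A \<inter> {a + 2 ^ k..}"
  have A: "A = B \<union> C" and disj: "B \<inter> C = {}" by (auto simp: B_def C_def)
  have finBC: "finite B" "finite C" using fin by (auto simp: B_def C_def)
  have "\<exists>z. (\<Sum>x\<in>B - {z}. d x) \<le> k * 2 ^ k"
    using Suc.prems by (intro Suc.IH[of B a]) (auto simp: B_def)
  then obtain y where y: "(\<Sum>x\<in>B - {y}. d x) \<le> k * 2 ^ k" ..
  have "\<exists>z. (\<Sum>x\<in>C - {z}. d x) \<le> k * 2 ^ k"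
    using Suc.prems by (intro Suc.IH[of C "a + 2 ^ k"]) (auto simp: C_def)
  then obtain z where z: "(\<Sum>x\<in>C - {z}. d x) \<le> k * 2 ^ k" ..
  have insert_bound: "(\<Sum>x\<in>D. d x) \<le> (\<Sum>x\<in>D - {w}. d x) + d w" if "finite D" for D w
    using that by (cases "w \<in> D") (auto simp: sum.remove)
  \<comment> \<open>The exceptional point of a half need not belong to it. If it does not, nothing
    was left out there, and the exception of the other half serves for \<open>A\<close>.\<close>
  consider "y \<notin> B" | "z \<notin> C" | "y \<in> B" "z \<in> C" by blast
  then show ?case
  proof cases
    case 1
    then have "(\<Sum>x\<in>B. d x) \<le> k * 2 ^ k" using y by simp
    moreover have "(\<Sum>x\<in>A - {z}. d x) \<le> (\<Sum>x\<in>B. d x) + (\<Sum>x\<in>C - {z}. d x)"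
      using finBC disj A by (subst sum.union_disjoint[symmetric]) (auto intro!: sum_mono2)
    ultimately show ?thesis using z by (intro exI[of _ z]) simp
  next
    case 2
    then have "(\<Sum>x\<in>C. d x) \<le> k * 2 ^ k" using z by simp
    moreover have "(\<Sum>x\<in>A - {y}. d x) \<le> (\<Sum>x\<in>B - {y}. d x) + (\<Sum>x\<in>C. d x)"
      using finBC disj A by (subst sum.union_disjoint[symmetric]) (auto intro!: sum_mono2)
    ultimately show ?thesis using y by (intro exI[of _ y]) simp
  next
    case 3
    then have yz: "y \<in> A" "z \<in> A" "y < z" by (auto simp: B_def C_def)
    have "min (d y) (d z) \<le> z - y" using Suc.prems(2) yz by blast
    moreover have "a \<le> y" "z < a + 2 ^ Suc k"
      using yz Suc.prems(1) by (auto simp del: power_Suc)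
    then have "z - y \<le> 2 ^ Suc k" by linarith
    ultimately have "d y \<le> 2 ^ Suc k \<or> d z \<le> 2 ^ Suc k" by linarith
    then show ?thesis
    proof
      assume "d y \<le> 2 ^ Suc k"
      moreover have "(\<Sum>x\<in>A - {z}. d x) \<le> (\<Sum>x\<in>B. d x) + (\<Sum>x\<in>C - {z}. d x)"
        using finBC disj A by (subst sum.union_disjoint[symmetric]) (auto intro!: sum_mono2)
      ultimately show ?thesis
        using y z insert_bound[OF finBC(1), of y] by (intro exI[of _ z]) simp
    next
      assume "d z \<le> 2 ^ Suc k"
      moreover have "(\<Sum>x\<in>A - {y}. d x) \<le> (\<Sum>x\<in>B - {y}. d x) + (\<Sum>x\<in>C. d x)"
        using finBC disj A by (subst sum.union_disjoint[symmetric]) (auto intro!: sum_mono2)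
      ultimately show ?thesis
        using y z insert_bound[OF finBC(2), of z] by (intro exI[of _ y]) simp
    qed
  qed
qed

text \<open>Double counting of the weights \<open>d g x\<close>. Every x in \<open>A\<close> is at
  least 2^j, so \<open>cover\<close> makes the total at least 2^j * card A. For fixed g, all points
  but one contribute at most k * 2^k, and the exceptional one less than 2^(j+1) by
  \<open>le\<close>; this is the summand 2 in k + 2.\<close>

lemma card_dyadic_block_le:
  fixes d :: "'b \<Rightarrow> nat \<Rightarrow> nat"
  assumes A: "A \<subseteq> {a..<a + 2 ^ k}" "A \<subseteq> {2 ^ j..<2 ^ Suc j}" and "k \<le> j"
    and sep: "\<And>g x y. g \<in> S \<Longrightarrow> x \<in> A \<Longrightarrow> y \<in> A \<Longrightarrow> x < y \<Longrightarrow> min (d g x) (d g y) \<le> y - x"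
    and le: "\<And>g x. g \<in> S \<Longrightarrow> x \<in> A \<Longrightarrow> d g x \<le> x"
    and cover: "\<And>x. x \<in> A \<Longrightarrow> x \<le> (\<Sum>g\<in>S. d g x)"
  shows "card A \<le> card S * (k + 2)"
proof -
  have fin: "finite A" using A(1) finite_subset by blast
  have bound: "(\<Sum>x\<in>A. d g x) \<le> 2 ^ j * (k + 2)" if g: "g \<in> S" for g
  proof -
    obtain z where z: "(\<Sum>x\<in>A - {z}. d g x) \<le> k * 2 ^ k"
      using sum_bound_except_one[OF A(1), of "d g"] sep[OF g] by blast
    also have "k * 2 ^ k \<le> k * 2 ^ j" using \<open>k \<le> j\<close> by simp
    finally have z': "(\<Sum>x\<in>A - {z}. d g x) \<le> k * 2 ^ j" .
    show ?thesis
    proof (cases "z \<in> A")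
      case True
      then have "d g z \<le> 2 ^ Suc j" using le[OF g True] A(2) by fastforce
      then show ?thesis using z' True fin by (simp add: sum.remove algebra_simps)
    next
      case False
      then have "(\<Sum>x\<in>A. d g x) \<le> k * 2 ^ j" using z' by simp
      then show ?thesis by (simp add: algebra_simps)
    qed
  qed
  have "2 ^ j * card A = (\<Sum>x\<in>A. 2 ^ j)" by simp
  also have "\<dots> \<le> (\<Sum>x\<in>A. \<Sum>g\<in>S. d g x)"
  proof (intro sum_mono)
    fix x assume "x \<in> A"
    then show "2 ^ j \<le> (\<Sum>g\<in>S. d g x)" using A(2) cover[of x] by fastforce
  qed
  also have "\<dots> = (\<Sum>g\<in>S. \<Sum>x\<in>A. d g x)" by (rule sum.swap)
  also have "\<dots> \<le> (\<Sum>g\<in>S. 2 ^ j * (k + 2))" by (intro sum_mono bound)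
  also have "\<dots> = 2 ^ j * (card S * (k + 2))" by (simp add: algebra_simps)
  finally show ?thesis by (subst (asm) nat_mult_le_cancel_disj) simp
qed

text \<open>The dyadic blocks 0, ..., J cover \<open>A\<close>, and each contributes at most card S
  * (K + 2).\<close>

lemma card_interval_subset_le:
  fixes d :: "'b \<Rightarrow> nat \<Rightarrow> nat"
  assumes A: "A \<subseteq> {m + 1..m + H}" and K: "H \<le> 2 ^ K" and J: "m + H < 2 ^ Suc J"
    and sep: "\<And>g x y. g \<in> S \<Longrightarrow> x \<in> A \<Longrightarrow> y \<in> A \<Longrightarrow> x < y \<Longrightarrow> min (d g x) (d g y) \<le> y - x"
    and le: "\<And>g x. g \<in> S \<Longrightarrow> x \<in> A \<Longrightarrow> d g x \<le> x"
    and cover: "\<And>x. x \<in> A \<Longrightarrow> x \<le> (\<Sum>g\<in>S. d g x)"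
  shows "card A \<le> card S * (K + 2) * (J + 1)"
proof -
  define B where "B = (\<lambda>j. A \<inter> {2 ^ j..<2 ^ Suc j})"
  have B: "card (B j) \<le> card S * (K + 2)" for j
  proof -
    \<comment> \<open>The part of \<open>A\<close> in block j starts no earlier than either left
      end. A window of length 2^k from \<open>a\<close> contains it: the block has length 2^j and
      the interval has length at most 2^K. The minimum also ensures k \<le> j.\<close>
    define a k where "a = max (2 ^ j) (m + 1)" and "k = min j K"
    have "x < a + 2 ^ k" if "x \<in> B j" for x
    proof -
      have "x < 2 ^ j + 2 ^ j" "x < m + 1 + H" using that A by (auto simp: B_def)
      then show ?thesis using K by (cases "j \<le> K") (auto simp: a_def k_def)
    qed
    then have "B j \<subseteq> {a..<a + 2 ^ k}" using A by (auto simp: B_def a_def)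
    then have "card (B j) \<le> card S * (k + 2)"
      using sep le cover by (intro card_dyadic_block_le[of _ a k j S d]) (auto simp: B_def k_def)
    also have "\<dots> \<le> card S * (K + 2)" by (simp add: k_def)
    finally show ?thesis .
  qed
  have "A \<subseteq> (\<Union>j\<in>{..J}. B j)"
  proof
    fix x assume x: "x \<in> A"
    then have "1 \<le> x" and xJ: "x < 2 ^ Suc J" using A J by auto
    then obtain j where j: "2 ^ j \<le> x" "x < 2 ^ (j + 1)" using ex_power_ivl1[of 2 x] by auto
    have "(2::nat) ^ j < 2 ^ Suc J" using j(1) xJ by (rule le_less_trans)
    then have "j < Suc J" by (rule power_less_imp_less_exp[rotated]) simp
    then show "x \<in> (\<Union>j\<in>{..J}. B j)" using x j by (auto simp: B_def)
  qed
  moreover have "finite A" using A finite_subset by blast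
  ultimately have "card A \<le> card (\<Union>j\<in>{..J}. B j)" by (intro card_mono) (auto simp: B_def)
  also have "\<dots> \<le> (\<Sum>j\<in>{..J}. card (B j))" by (intro card_UN_le) simp
  also have "\<dots> \<le> (\<Sum>j\<in>{..J}. card S * (K + 2))" by (intro sum_mono B)
  finally show ?thesis by (simp add: algebra_simps)
qed

text \<open>\<open>K\<close> and \<open>J\<close> are the integer parts of the binary logarithms of
  H and m + H. Both are at least 1, which absorbs the additive constants and yields the factor 8;
  passing to natural logarithms costs the two factors 1 / ln 2.\<close>

lemma card_interval_subset_le_ln:
  fixes d :: "'b \<Rightarrow> nat \<Rightarrow> nat" and m H :: nat
  assumes A: "A \<subseteq> {m + 1..m + H}" and "H \<ge> 2"
    and sep: "\<And>g x y. g \<in> S \<Longrightarrow> x \<in> A \<Longrightarrow> y \<in> A \<Longrightarrow> x < y \<Longrightarrow> min (d g x) (d g y) \<le> y - x"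
    and le: "\<And>g x. g \<in> S \<Longrightarrow> x \<in> A \<Longrightarrow> d g x \<le> x"
    and cover: "\<And>x. x \<in> A \<Longrightarrow> x \<le> (\<Sum>g\<in>S. d g x)"
  shows "real (card A) \<le> 8 / (ln 2)\<^sup>2 * card S * ln H * ln (real (m + H))"
proof -
  have dyadic: "\<exists>l\<ge>1. n < 2 ^ Suc l \<and> l * ln 2 \<le> ln n" if n: "n \<ge> 2" for n :: nat
  proof -
    obtain l where l: "2 ^ l \<le> n" "n < 2 ^ (l + 1)" using ex_power_ivl1[of 2 n] n by auto
    have "l \<ge> 1" using l n by (cases l) auto
    moreover have "l * ln 2 = ln (2 ^ l :: real)" by (simp add: ln_realpow)
    moreover have "2 ^ l \<le> real n" using l(1) by (metis of_nat_le_iff of_nat_numeral of_nat_power)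
    ultimately show ?thesis using l(2) n by (intro exI[of _ l]) auto
  qed
  obtain K where K: "K \<ge> 1" "H < 2 ^ Suc K" "K * ln 2 \<le> ln H" using dyadic[OF \<open>H \<ge> 2\<close>] by blast
  obtain J where J: "J \<ge> 1" "m + H < 2 ^ Suc J" "J * ln 2 \<le> ln (real (m + H))"
    using dyadic[of "m + H"] \<open>H \<ge> 2\<close> by auto
  \<comment> \<open>The exponent is \<open>Suc K\<close> because 2^K may be smaller than H.\<close>
  have "card A \<le> card S * (Suc K + 2) * (J + 1)"
    using A K(2) J(2) sep le cover by (intro card_interval_subset_le[of A m H _ J S d]) auto
  also have "\<dots> \<le> card S * (4 * K) * (2 * J)"
    using K(1) J(1) by (intro mult_mono) auto
  finally have "real (card A) \<le> real (card S * (4 * K) * (2 * J))" by (rule of_nat_mono)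
  also have "\<dots> = 8 / (ln 2)\<^sup>2 * card S * ((K * ln 2) * (J * ln 2))"
    by (simp add: power2_eq_square)
  also have "\<dots> \<le> 8 / (ln 2)\<^sup>2 * card S * (ln H * ln (real (m + H)))"
    using K(3) J(3) \<open>H \<ge> 2\<close> by (intro mult_left_mono mult_mono) auto
  finally show ?thesis by (simp add: mult.assoc)
qed

section \<open>Common divisors of two members of the sequence\<close>

text \<open>Appending k zeros multiplies by X^k. As the constant term of \<open>p\<close> is
  non-zero, the factors X must come from the cofactor and can be cancelled one at a time.\<close>

lemma (in domain) pdivides_append_zeros:
  assumes p: "p \<in> carrier (poly_ring R)" "const_term p \<noteq> \<zero>"
    and r: "set r \<subseteq> carrier R" "r \<noteq> []"
    and dvd: "p pdivides (r @ replicate k \<zero>)"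
  shows "p pdivides r"
  using dvd
proof (induction k)
  case 0
  then show ?case by simp
next
  case (Suc k)
  let ?r = "r @ replicate k \<zero>"
  have snoc: "r @ replicate (Suc k) \<zero> = ?r @ [\<zero>]" by (simp add: replicate_append_same)
  obtain q where q: "q \<in> carrier (poly_ring R)" "?r @ [\<zero>] = p \<otimes>\<^bsub>poly_ring R\<^esub> q"
    using Suc.prems unfolding pdivides_def factor_def snoc by blast
  have "set ?r \<subseteq> carrier R" using r(1) by auto
  then have "const_term p \<otimes> const_term q = \<zero>"
    using const_term_eq_last[of ?r \<zero>] const_term_simprules_shell(2)[OF carrier_is_subring p(1) q(1)]
      q(2) by simp
  then have "const_term q = \<zero>"
    using p const_term_simprules_shell(1)[OF carrier_is_subring] q(1) integral by blast
  have qpoly: "polynomial (carrier R) q" using q(1) by (simp add: univ_poly_carrier)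
  have ppoly: "polynomial (carrier R) p" using p(1) by (simp add: univ_poly_carrier)
  \<comment> \<open>A zero cofactor would make the product the empty list, but the left side ends in
    an explicit zero coefficient.\<close>
  have "q \<noteq> []"
    using q(2) poly_mult_zero(2)[OF polynomial_incl[OF ppoly]] by (auto simp: univ_poly_mult)
  then obtain s b where s: "q = s @ [b]" by (cases q rule: rev_cases) auto
  have "set s \<subseteq> carrier R" "b \<in> carrier R" using polynomial_incl[OF qpoly] s by auto
  then have "b = \<zero>" using const_term_eq_last s \<open>const_term q = \<zero>\<close> by simp
  then have s_poly: "polynomial (carrier R) s"
    using qpoly s by (cases s) (auto simp: polynomial_def)
  \<comment> \<open>Here q is s times X, so one factor X cancels on both sides.\<close>
  have "poly_mult p s = ?r"
    using poly_mult_append_zero_rcancel[OF carrier_is_subring ppoly s_poly] q(2) s \<open>b = \<zero>\<close>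
    by (simp add: univ_poly_mult)
  then have "p pdivides ?r"
    unfolding pdivides_def factor_def using s_poly
    by (force simp: univ_poly_mult simp flip: univ_poly_carrier)
  then show ?case by (rule Suc.IH)
qed

text \<open>A common divisor divides the difference, which is X^(n+1) times the polynomial
  \<open>r\<close> of the n' - n top coefficients. Its constant term is a factor of
  \<open>u 0\<close>, hence non-zero, so it already divides \<open>r\<close>, of degree n' - n -
  1.\<close>

lemma (in domain) consecutive_poly_common_divisor_degree:
  assumes u: "\<And>n. u n \<in> carrier R - {\<zero>}" and "n < n'"
    and p: "p \<in> carrier (poly_ring R)"
    and dvd: "p pdivides (consecutive_poly u n)" "p pdivides (consecutive_poly u n')"
  shows "degree p < n' - n"
proof -
  interpret UP: domain "poly_ring R"
    using univ_poly_is_domain[OF carrier_is_subring] .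
  define r where "r = map u (rev [Suc n..<Suc n'])"
  have r: "set r \<subseteq> carrier R" "r \<noteq> []" "length r = n' - n"
    and rc: "r \<in> carrier (poly_ring R)"
    using u \<open>n < n'\<close> by (auto simp: r_def univ_poly_def polynomial_def)
  have fc: "consecutive_poly u k \<in> carrier (poly_ring R)" for k
    using u by (rule consecutive_poly_carrier)
  have len: "length (consecutive_poly u k) = Suc k" for k
    by (simp add: consecutive_poly_def)
  define t where "t = r @ replicate (Suc n) \<zero>"
  have tc: "t \<in> carrier (poly_ring R)"
    using append_is_polynomial[OF carrier_is_subring _ r(2)] rc
    by (simp add: t_def univ_poly_carrier del: replicate_Suc)
  have "[0..<Suc n'] = [0..<Suc n] @ [Suc n..<Suc n']"
    using \<open>n < n'\<close> upt_add_eq_append[of 0 "Suc n" "n' - n"] by (simp del: upt_Suc)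
  then have "consecutive_poly u n' = r @ consecutive_poly u n"
    by (simp only: consecutive_poly_def r_def map_append rev_append)
  \<comment> \<open>Filling the trailing zeros of \<open>t\<close> with the coefficients of the
    shorter polynomial gives the longer one. The \<open>normalize\<close> is harmless since the
    leading coefficient \<open>u n'\<close> is non-zero.\<close>
  moreover have "poly_add t (consecutive_poly u n) = normalize (r @ consecutive_poly u n)"
    using poly_add_append_replicate[OF r(1), of "consecutive_poly u n"] len
      polynomial_incl[of "carrier R" "consecutive_poly u n"] fc[of n]
    unfolding t_def univ_poly_carrier by metis
  ultimately have "consecutive_poly u n' = t \<oplus>\<^bsub>poly_ring R\<^esub> consecutive_poly u n"
    using normalize_polynomial[of "carrier R" "consecutive_poly u n'"] fc[of n']
    by (simp add: univ_poly_add univ_poly_carrier)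
  then have t: "t = consecutive_poly u n' \<ominus>\<^bsub>poly_ring R\<^esub> consecutive_poly u n"
    using tc fc[of n] by (simp add: a_minus_def UP.a_assoc UP.r_neg)
  obtain q where q: "q \<in> carrier (poly_ring R)" "consecutive_poly u n = p \<otimes>\<^bsub>poly_ring R\<^esub> q"
    using dvd(1) unfolding pdivides_def factor_def by blast
  obtain q' where q': "q' \<in> carrier (poly_ring R)" "consecutive_poly u n' = p \<otimes>\<^bsub>poly_ring R\<^esub> q'"
    using dvd(2) unfolding pdivides_def factor_def by blast
  have "t = p \<otimes>\<^bsub>poly_ring R\<^esub> (q' \<ominus>\<^bsub>poly_ring R\<^esub> q)"
    using p q q' unfolding t a_minus_def by (simp add: UP.r_distr UP.r_minus)
  then have "p pdivides t"
    using q(1) q'(1) unfolding pdivides_def factor_def by blast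
  have "consecutive_poly u n = map u (rev [Suc 0..<Suc n]) @ [u 0]"
    by (simp add: consecutive_poly_def upt_conv_Cons del: upt_Suc)
  moreover have "set (map u (rev [Suc 0..<Suc n])) \<subseteq> carrier R" "u 0 \<in> carrier R" using u by auto
  ultimately have "const_term (consecutive_poly u n) = u 0" using const_term_eq_last by metis
  then have "const_term p \<otimes> const_term q \<noteq> \<zero>"
    using const_term_simprules_shell(2)[OF carrier_is_subring p q(1)] q(2) u by simp
  then have "const_term p \<noteq> \<zero>"
    using const_term_simprules_shell(1)[OF carrier_is_subring q(1)] by auto
  then have "p pdivides r"
    using pdivides_append_zeros[OF p _ r(1,2)] \<open>p pdivides t\<close> unfolding t_def by blast
  then have "degree p \<le> degree r"
    using pdivides_imp_degree_le[OF carrier_is_subring p rc r(2)] by blast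
  then show ?thesis using r(3) \<open>n < n'\<close> by simp
qed

section \<open>Factorisation over S\<close>

text \<open>Induction on the degree, splitting off one factor from \<open>S\<close> at a time.
  \<open>S\<close> may contain several associates of one polynomial; its multiplicity is then shared
  among them, so \<open>e g\<close> is not claimed to be the full multiplicity of
  \<open>g\<close>.\<close>

lemma (in field) S_polynomial_factor_degrees:
  assumes S: "finite S" "S \<subseteq> carrier (poly_ring R)" and f: "S_polynomial R S f" "f \<noteq> []"
  shows "\<exists>e :: 'a list \<Rightarrow> nat. degree f = (\<Sum>g\<in>S. degree (g [^]\<^bsub>poly_ring R\<^esub> e g)) \<and>
           (\<forall>g\<in>S. (g [^]\<^bsub>poly_ring R\<^esub> e g) pdivides f)"
  using f
proof (induction "degree f" arbitrary: f rule: less_induct)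
  interpret UP: principal_domain "poly_ring R"
    using univ_poly_is_principal[OF carrier_is_subfield] .
  case less
  have fc: "f \<in> carrier (poly_ring R)" using less.prems by (simp add: S_polynomial_def)
  show ?case
  proof (cases "degree f = 0")
    case True
    have "\<one>\<^bsub>poly_ring R\<^esub> divides\<^bsub>poly_ring R\<^esub> f" using fc by (simp add: UP.one_divides)
    then show ?thesis using True
      by (intro exI[of _ "\<lambda>_. 0"]) (simp add: pdivides_def, simp add: univ_poly_one)
  next
    case False
    \<comment> \<open>Over a field the units are the non-zero constants, so a non-constant
      polynomial has an irreducible divisor.\<close>
    then have "f \<notin> Units (poly_ring R)" "f \<in> carrier (poly_ring R) - {[]}"
      using univ_poly_units'[OF carrier_is_subfield, of f] fc by auto
    then obtain q where q: "q \<in> carrier (poly_ring R)" "pirreducible (carrier R) q" "q pdivides f"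
      using UP.exists_irreducible_divisor[of f] unfolding univ_poly_zero pdivides_def by auto
    then obtain h c where h: "h \<in> S" "c \<in> carrier R - {\<zero>}" "q = [c] \<otimes>\<^bsub>poly_ring R\<^esub> h"
      using less.prems(1) unfolding S_polynomial_def by blast
    have hc: "h \<in> carrier (poly_ring R)" using h S by blast
    have assoc: "q \<sim>\<^bsub>poly_ring R\<^esub> h"
      using associated_polynomials_iff[OF carrier_is_subfield q(1) hc] h by blast
    \<comment> \<open>Read off from the associate \<open>q\<close>; this makes the degree drop when
      \<open>h\<close> is divided out.\<close>
    then have "degree h \<ge> 1"
      using associated_polynomials_imp_same_length[OF carrier_is_subring q(1) hc]
        pirreducible_degree[OF carrier_is_subfield q(1,2)] by simp
    have "h pdivides f"
      using UP.divides_cong_l[OF UP.associated_sym[OF assoc]] q hc fc by (auto simp: pdivides_def)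
    then obtain f' where f': "f' \<in> carrier (poly_ring R)" "f = h \<otimes>\<^bsub>poly_ring R\<^esub> f'"
      unfolding pdivides_def factor_def by blast
    have "f' \<noteq> []"
      using f'(2) less.prems(2) hc UP.r_null by (auto simp: univ_poly_zero)
    then have deg: "degree f = degree h + degree f'"
      using poly_mult_degree_eq[OF carrier_is_subring, of h f'] hc f' \<open>degree h \<ge> 1\<close>
      by (auto simp: univ_poly_carrier univ_poly_mult)
    have f'_dvd: "f' pdivides f"
      using f' hc UP.m_comm by (auto simp: pdivides_def factor_def)
    have trans_f: "g pdivides f" if "g pdivides f'" "g \<in> carrier (poly_ring R)" for g
      using that f'_dvd UP.divides_trans unfolding pdivides_def by blast
    \<comment> \<open>Every irreducible factor of f' also divides f.\<close>
    then have f'_S: "S_polynomial R S f'"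
      using less.prems(1) f'(1) unfolding S_polynomial_def by blast
    have "degree f' < degree f" using deg \<open>degree h \<ge> 1\<close> by linarith
    from less.hyps[OF this f'_S \<open>f' \<noteq> []\<close>]
    obtain e :: "'a list \<Rightarrow> nat" where e: "degree f' = (\<Sum>g\<in>S. degree (g [^]\<^bsub>poly_ring R\<^esub> e g))"
      "\<And>g. g \<in> S \<Longrightarrow> (g [^]\<^bsub>poly_ring R\<^esub> e g) pdivides f'"
      by blast
    let ?e = "e(h := Suc (e h))"
    \<comment> \<open>Raising the exponent at \<open>h\<close> changes only that summand, by
      \<open>degree h\<close>.\<close>
    have "(\<Sum>g\<in>S. degree (g [^]\<^bsub>poly_ring R\<^esub> ?e g)) =
        degree (h [^]\<^bsub>poly_ring R\<^esub> Suc (e h)) + (\<Sum>g\<in>S - {h}. degree (g [^]\<^bsub>poly_ring R\<^esub> e g))"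
      using S(1) h(1) by (subst sum.remove[of _ h]) (auto intro!: sum.cong)
    also have "\<dots> = degree h + degree f'"
      using S(1) h(1) e(1) polynomial_pow_degree[OF hc, of "Suc (e h)"] polynomial_pow_degree[OF hc, of "e h"]
      by (simp add: sum.remove[of _ h] del: UP.nat_pow_Suc)
    finally have "degree f = (\<Sum>g\<in>S. degree (g [^]\<^bsub>poly_ring R\<^esub> ?e g))" using deg by simp
    moreover have "(g [^]\<^bsub>poly_ring R\<^esub> ?e g) pdivides f" if "g \<in> S" for g
    proof (cases "g = h")
      case True
      have "h [^]\<^bsub>poly_ring R\<^esub> Suc (e h) = h \<otimes>\<^bsub>poly_ring R\<^esub> h [^]\<^bsub>poly_ring R\<^esub> e h"
        using UP.nat_pow_Suc2[OF hc] .
      then show ?thesis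
        using e(2)[OF h(1)] UP.divides_mult_lI[of _ f' h] hc f' True by (simp add: pdivides_def)
    next
      case False
      then show ?thesis using trans_f e(2) that S(2) by auto
    qed
    ultimately show ?thesis by blast
  qed
qed

text \<open>The weight \<open>d g n\<close> is the degree of the power of \<open>g\<close> split off
  from the n-th polynomial, so that for S-polynomials the weights add up to n.\<close>

lemma (in field) Q_le:
  assumes u: "\<And>n. u n \<in> carrier R - {\<zero>}" and S: "finite S" "S \<subseteq> carrier (poly_ring R)"
    and "H \<ge> 2"
  shows "real (Q R u S m H) \<le> 8 / (ln 2)\<^sup>2 * card S * ln H * ln (real (m + H))"
proof -
  interpret UP: domain "poly_ring R"
    using univ_poly_is_domain[OF carrier_is_subring] .
  let ?f = "consecutive_poly u"
  let ?A = "{n \<in> {m + 1..m + H}. S_polynomial R S (?f n)}"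
  have fc: "?f n \<in> carrier (poly_ring R)" for n
    using u by (rule consecutive_poly_carrier)
  have f: "?f n \<noteq> []" "degree (?f n) = n" for n
    by (simp_all add: consecutive_poly_def)
  \<comment> \<open>Naming the property allows exponents to be chosen simultaneously for all n in
    \<open>?A\<close>.\<close>
  define P where "P n e \<longleftrightarrow> n = (\<Sum>g\<in>S. degree (g [^]\<^bsub>poly_ring R\<^esub> e g)) \<and>
           (\<forall>g\<in>S. (g [^]\<^bsub>poly_ring R\<^esub> e g) pdivides ?f n)" for n and e :: "'a list \<Rightarrow> nat"
  have "\<exists>e. P n e" if "n \<in> ?A" for n
    using S_polynomial_factor_degrees[OF S _ f(1)[of n]] that unfolding f(2) P_def by simp
  then obtain e where "\<And>n. n \<in> ?A \<Longrightarrow> P n (e n)" by metis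
  then have e: "\<And>n. n \<in> ?A \<Longrightarrow> n = (\<Sum>g\<in>S. degree (g [^]\<^bsub>poly_ring R\<^esub> e n g))"
      "\<And>n g. n \<in> ?A \<Longrightarrow> g \<in> S \<Longrightarrow> (g [^]\<^bsub>poly_ring R\<^esub> e n g) pdivides ?f n"
    unfolding P_def by blast+
  define d where "d g n = degree (g [^]\<^bsub>poly_ring R\<^esub> e n g)" for g n
  have sep: "min (d g x) (d g y) \<le> y - x" if g: "g \<in> S" and xy: "x \<in> ?A" "y \<in> ?A" "x < y" for g x y
  proof -
    have gc: "g \<in> carrier (poly_ring R)" using g S by blast
    \<comment> \<open>The smaller of the two powers divides both polynomials, and its degree is the
      minimum of the two weights because the degree of a power is linear in the exponent.\<close>
    let ?p = "g [^]\<^bsub>poly_ring R\<^esub> min (e x g) (e y g)"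
    have pc: "?p \<in> carrier (poly_ring R)" using gc by simp
    have dvd: "?p pdivides ?f n" if "n \<in> {x, y}" for n
    proof -
      have "?p pdivides (g [^]\<^bsub>poly_ring R\<^esub> e n g)"
        using polynomial_pow_division[OF gc] that by auto
      then show ?thesis
        using e(2)[of n g] that xy g UP.divides_trans[OF _ _ pc] unfolding pdivides_def by blast
    qed
    have "degree ?p < y - x"
      by (rule consecutive_poly_common_divisor_degree[OF u \<open>x < y\<close> pc dvd dvd]) simp_all
    moreover have "degree ?p = min (d g x) (d g y)"
      unfolding d_def polynomial_pow_degree[OF gc] by (simp add: min_def)
    ultimately show ?thesis by simp
  qed
  have le: "d g x \<le> x" if "g \<in> S" "x \<in> ?A" for g x
  proof -
    have "g [^]\<^bsub>poly_ring R\<^esub> e x g \<in> carrier (poly_ring R)"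
      using that(1) S(2) by (intro UP.nat_pow_closed) blast
    then have "d g x \<le> degree (?f x)"
      using pdivides_imp_degree_le[OF carrier_is_subring _ fc f(1) e(2)[OF that(2,1)]]
      by (simp only: d_def)
    then show ?thesis unfolding f(2) .
  qed
  have cover: "x \<le> (\<Sum>g\<in>S. d g x)" if "x \<in> ?A" for x
    unfolding d_def by (rule eq_refl[OF e(1)[OF that]])
  show ?thesis
    unfolding Q_def by (rule card_interval_subset_le_ln[OF _ \<open>H \<ge> 2\<close> sep le cover]) auto
qed

theorem theorem4p3:
  "\<exists>c::real. c > 0 \<and>
     (\<forall>(F :: 'a ring) (p::nat) (s::nat) (u :: nat \<Rightarrow> 'a) (S :: 'a list set) (m::nat) (H::nat).
        Factorial_Ring.prime p \<longrightarrow> odd p \<longrightarrow> s \<ge> 1 \<longrightarrow>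
        field F \<longrightarrow> finite (carrier F) \<longrightarrow> card (carrier F) = p ^ s \<longrightarrow>
        (\<forall>n. u n \<in> carrier F - {\<zero>\<^bsub>F\<^esub>}) \<longrightarrow>
        finite S \<longrightarrow>
        (\<forall>g\<in>S. g \<in> carrier (poly_ring F) \<and> pirreducible\<^bsub>F\<^esub> (carrier F) g) \<longrightarrow>
        H \<ge> 2 \<longrightarrow>
        real (Q F u S m H) \<le> c * real (card S) * ln (real H) * ln (real (m + H)))"
\<comment> \<open>The constant is fixed before the field and all other parameters, so it is
  absolute.\<close>
proof (intro exI[of _ "8 / (ln 2)\<^sup>2"] conjI allI impI)
  show "0 < 8 / (ln 2 :: real)\<^sup>2" by simp
next
  fix F :: "'a ring" and u :: "nat \<Rightarrow> 'a" and S :: "'a list set" and m H :: nat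
  assume "field F" and u: "\<forall>n. u n \<in> carrier F - {\<zero>\<^bsub>F\<^esub>}" and S: "finite S"
    "\<forall>g\<in>S. g \<in> carrier (poly_ring F) \<and> pirreducible\<^bsub>F\<^esub> (carrier F) g" and "H \<ge> 2"
  then interpret field F by simp
  show "real (Q F u S m H) \<le> 8 / (ln 2)\<^sup>2 * real (card S) * ln (real H) * ln (real (m + H))"
    using Q_le[of u S H m] u S \<open>H \<ge> 2\<close> by blast
qed

end
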